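(* Let $S$ be a regular AG-groupoid that is a left duo. Then every intuitionistic fuzzy left ideal of $S$ is an intuitionistic fuzzy right ideal of $S$.
   Context: An AG-groupoid is a non-empty set $S$ with a binary operation satisfying the left invertive law $(ab)c=(cb)a$ for all $a,b,c\in S$ (no associativity is assumed). $S$ is regular if for every $a\in S$ there is $x\in S$ with $a=(ax)a$. A non-empty subset $B\subseteq S$ is a left ideal if $SB\subseteq B$, a right ideal if $BS\subseteq B$, and a two-sided ideal if it is both. $S$ is a left duo if every left ideal of $S$ is a two-sided ideal. An intuitionistic fuzzy set (IFS) of $S$ is a pair $A=(\mu_A,\gamma_A)$ of functions $\mu_A,\gamma_A:S\to[0,1]$ with $0\le \mu_A(x)+\gamma_A(x)\le 1$ for all $x\in S$. An IFS $A$ is an intuitionistic fuzzy left ideal if $\mu_A(xy)\ge\mu_A(y)$ and $\gamma_A(xy)\le\gamma_A(y)$ for all $x,y\in S$, and an intuitionistic fuzzy right ideal if $\mu_A(xy)\ge\mu_A(x)$ and $\gamma_A(xy)\le\gamma_A(x)$ for all $x,y\in S$. *)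

theory Defs
  imports Complex_Main
begin

definition set_mult :: "('a \<Rightarrow> 'a \<Rightarrow> 'a) \<Rightarrow> 'a set \<Rightarrow> 'a set \<Rightarrow> 'a set" where
  "set_mult f A B = {f a b | a b. a \<in> A \<and> b \<in> B}"

locale ag_groupoid =
  fixes S :: "'a set" and f :: "'a \<Rightarrow> 'a \<Rightarrow> 'a" (infixl "\<cdot>" 70)
  assumes nonempty: "S \<noteq> {}"
    and closed: "a \<in> S \<Longrightarrow> b \<in> S \<Longrightarrow> a \<cdot> b \<in> S"
    and left_invertive: "a \<in> S \<Longrightarrow> b \<in> S \<Longrightarrow> c \<in> S \<Longrightarrow> (a \<cdot> b) \<cdot> c = (c \<cdot> b) \<cdot> a"

definition regular :: "'a set \<Rightarrow> ('a \<Rightarrow> 'a \<Rightarrow> 'a) \<Rightarrow> bool" where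
  "regular S f \<longleftrightarrow> (\<forall>a\<in>S. \<exists>x\<in>S. a = f (f a x) a)"

definition left_ideal :: "'a set \<Rightarrow> ('a \<Rightarrow> 'a \<Rightarrow> 'a) \<Rightarrow> 'a set \<Rightarrow> bool" where
  "left_ideal S f B \<longleftrightarrow> B \<noteq> {} \<and> B \<subseteq> S \<and> set_mult f S B \<subseteq> B"

definition right_ideal :: "'a set \<Rightarrow> ('a \<Rightarrow> 'a \<Rightarrow> 'a) \<Rightarrow> 'a set \<Rightarrow> bool" where
  "right_ideal S f B \<longleftrightarrow> B \<noteq> {} \<and> B \<subseteq> S \<and> set_mult f B S \<subseteq> B"

definition two_sided_ideal :: "'a set \<Rightarrow> ('a \<Rightarrow> 'a \<Rightarrow> 'a) \<Rightarrow> 'a set \<Rightarrow> bool" where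
  "two_sided_ideal S f B \<longleftrightarrow> left_ideal S f B \<and> right_ideal S f B"

definition left_duo :: "'a set \<Rightarrow> ('a \<Rightarrow> 'a \<Rightarrow> 'a) \<Rightarrow> bool" where
  "left_duo S f \<longleftrightarrow> (\<forall>B. left_ideal S f B \<longrightarrow> two_sided_ideal S f B)"

text \<open>
  A fuzzy set of the carrier \<open>S\<close> is given by total functions whose values outside \<open>S\<close>
  are irrelevant: every condition below is relativised to \<open>S\<close>.
\<close>

type_synonym 'a ifs = "('a \<Rightarrow> real) \<times> ('a \<Rightarrow> real)"

abbreviation membership :: "'a ifs \<Rightarrow> 'a \<Rightarrow> real" ("\<mu>") where
  "\<mu> A \<equiv> fst A"

abbreviation nonmembership :: "'a ifs \<Rightarrow> 'a \<Rightarrow> real" ("\<gamma>") where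
  "\<gamma> A \<equiv> snd A"

definition intuitionistic_fuzzy_set :: "'a set \<Rightarrow> 'a ifs \<Rightarrow> bool" where
  "intuitionistic_fuzzy_set S A \<longleftrightarrow>
     (\<forall>x\<in>S. \<mu> A x \<in> {0..1} \<and> \<gamma> A x \<in> {0..1} \<and> \<mu> A x + \<gamma> A x \<in> {0..1})"

definition if_left_ideal :: "'a set \<Rightarrow> ('a \<Rightarrow> 'a \<Rightarrow> 'a) \<Rightarrow> 'a ifs \<Rightarrow> bool" where
  "if_left_ideal S f A \<longleftrightarrow> intuitionistic_fuzzy_set S A \<and>
     (\<forall>x\<in>S. \<forall>y\<in>S. \<mu> A (f x y) \<ge> \<mu> A y \<and> \<gamma> A (f x y) \<le> \<gamma> A y)"

definition if_right_ideal :: "'a set \<Rightarrow> ('a \<Rightarrow> 'a \<Rightarrow> 'a) \<Rightarrow> 'a ifs \<Rightarrow> bool" where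
  "if_right_ideal S f A \<longleftrightarrow> intuitionistic_fuzzy_set S A \<and>
     (\<forall>x\<in>S. \<forall>y\<in>S. \<mu> A (f x y) \<ge> \<mu> A x \<and> \<gamma> A (f x y) \<le> \<gamma> A x)"

end

theory Submission imports Defs begin

text \<open>Duo-ness concerns crisp ideals and is carried over to fuzzy ones by level sets. Cutting
  \<open>A\<close> at the very values it takes at \<open>x\<close> gives a left ideal containing
  \<open>x\<close>; once this set is also a right ideal, it contains \<open>f x y\<close>, and that
  membership is the required pair of inequalities.\<close>

theorem lemma6:
  fixes S :: "'a set" and f :: "'a \<Rightarrow> 'a \<Rightarrow> 'a"
  assumes "ag_groupoid S f"
    and "regular S f"
    and "left_duo S f"
  shows "\<forall>A. if_left_ideal S f A \<longrightarrow> if_right_ideal S f A"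
proof (intro allI impI)
  fix A :: "'a ifs"
  assume A: "if_left_ideal S f A"
  have "\<mu> A (f x y) \<ge> \<mu> A x \<and> \<gamma> A (f x y) \<le> \<gamma> A x" if x: "x \<in> S" and y: "y \<in> S" for x y
  proof -
    \<comment> \<open>The level set of \<open>A\<close> through \<open>x\<close> is a left ideal, hence by duo-ness a right ideal.\<close>
    define L where "L = {z \<in> S. \<mu> A z \<ge> \<mu> A x \<and> \<gamma> A z \<le> \<gamma> A x}"
    have "x \<in> L"
      using x by (simp add: L_def)
    \<comment> \<open>Left multiplication never lowers \<open>\<mu> A\<close> nor raises
      \<open>\<gamma> A\<close>, so it cannot leave \<open>L\<close>.\<close>
    have "f s z \<in> L" if "s \<in> S" "z \<in> L" for s z
    proof -
      have "\<mu> A z \<le> \<mu> A (f s z)" "\<gamma> A (f s z) \<le> \<gamma> A z"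
        using that A by (simp_all add: L_def if_left_ideal_def)
      then show ?thesis
        using that ag_groupoid.closed[OF assms(1)] by (simp add: L_def)
    qed
    then have "left_ideal S f L"
      using \<open>x \<in> L\<close> by (auto simp: left_ideal_def set_mult_def L_def)
    then have "set_mult f L S \<subseteq> L"
      using assms(3) by (simp add: left_duo_def two_sided_ideal_def right_ideal_def)
    then have "f x y \<in> L"
      using \<open>x \<in> L\<close> y by (auto simp: set_mult_def)
    then show ?thesis
      by (simp add: L_def)
  qed
  then show "if_right_ideal S f A"
    using A by (simp add: if_left_ideal_def if_right_ideal_def)
qed

end
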